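(* Let $N\ge 3$, $\omega_1,\dots,\omega_N\in\mathbb{R}$, $\Gamma\in C^3(\mathbb{T},\mathbb{R})$ and $H\in C^3(\mathbb{T}^2,\mathbb{R})$. For small $\varepsilon>0$ consider on $\mathbb{T}^N\times\mathbb{R}^{N\times N}$ the adaptive network system $$\dot\theta_i=\omega_i+\frac1N\sum_{j=1}^N a_{ij}\,\Gamma(\theta_j-\theta_i),\qquad \varepsilon\,\dot a_{ij}=-a_{ij}+H(\theta_i,\theta_j),\qquad i,j=1,\dots,N.$$ Let $M_\varepsilon=\{(\theta,A):A=h_\varepsilon(\theta)\}$ be the associated (locally invariant, normally hyperbolic, attracting) slow manifold, and let $F^\varepsilon=(F^\varepsilon_1,\dots,F^\varepsilon_N):\mathbb{T}^N\to\mathbb{R}^N$ be the reduced phase vector field on $M_\varepsilon$, $$F_i^\varepsilon(\theta)=\omega_i+\frac1N\sum_{j=1}^N h_{\varepsilon,ij}(\theta)\,\Gamma(\theta_j-\theta_i).$$ For $i,r,s\in\{1,\dots,N\}$ set $$T_{irs}(\theta)=-\Gamma(\theta_r-\theta_i)\,\partial_1H(\theta_i,\theta_r)\,H(\theta_i,\theta_s)\,\Gamma(\theta_s-\theta_i)-\Gamma(\theta_r-\theta_i)\,\partial_2H(\theta_i,\theta_r)\,H(\theta_r,\theta_s)\,\Gamma(\theta_s-\theta_r).$$ Suppose there exist distinct indices $i,j,k$ and a point $\theta^*\in\mathbb{T}^N$ such that $$\partial_{\theta_j}\partial_{\theta_k}\Bigl(\sum_{r=1}^N\sum_{s=1}^N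 T_{irs}(\theta)\Bigr)\Big|_{\theta=\theta^*}\neq 0.$$ Then for all sufficiently small $\varepsilon>0$ the vector field $F^\varepsilon$ is not pairwise, i.e. $F^\varepsilon\notin\mathcal{V}_{\mathrm{pair}}$ (equivalently, the reduced dynamics on $M_\varepsilon$ are genuinely higher-order).
   Context: $\mathbb{T}=\mathbb{R}/2\pi\mathbb{Z}$; $\partial_1H,\partial_2H$ are the partial derivatives of $H(u,v)$ in its first and second argument; $A=(a_{ij})\in\mathbb{R}^{N\times N}$. Pairwise class: a $C^2$ vector field $F=(F_1,\dots,F_N):\mathbb{T}^N\to\mathbb{R}^N$ is pairwise, written $F\in\mathcal{V}_{\mathrm{pair}}$, if for each $i$ there exist functions $G_{ij}\in C^2(\mathbb{T}^2,\mathbb{R})$, $j=1,\dots,N$, with $F_i(\theta)=\sum_{j=1}^N G_{ij}(\theta_i,\theta_j)$ for all $\theta$. It is genuinely higher-order if $F\notin\mathcal{V}_{\mathrm{pair}}$. Slow manifold: the critical manifold is the compact graph $M_0=\{(\theta,A):A=h_0(\theta)\}$, $h_{0,ij}(\theta)=H(\theta_i,\theta_j)$; it is normally hyperbolic and attracting (the linearisation of the fast equation in $A$ is $-I_{N^2}$). The associated slow manifold is the family given by Fenichel's theorem: for all sufficiently small $\varepsilon>0$, a map $h_\varepsilon:\mathbb{T}^N\to\mathbb{R}^{N\times N}$ of class $C^3$ whose graph $M_\varepsilon$ is locally invariant under the flow of the system and is $O(\varepsilon)$-close to $M_0$ as $\varepsilon\to0$. *)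

theory Defs
  imports "HOL-Analysis.Analysis"
begin

text \<open>
  The torus \<open>(\<real>/2\<pi>\<int>)\<^sup>d\<close> is represented by its universal cover: a function on the torus is a
  function on the covering space (\<open>real\<close>, \<open>real \<times> real\<close>, \<open>real ^ 'n\<close>) which is
  \<open>2\<pi>\<close>-periodic in each coordinate. Points of the torus are represented by arbitrary lifts.
\<close>

text \<open>
  In finite dimension, continuity of all directional derivatives of order \<open>k\<close> is the same as
  continuity of the \<open>k\<close>-th Frechet derivative, so this is the usual class \<open>C\<^sup>k\<close>.
\<close>

primrec Ck :: "nat \<Rightarrow> ('a::euclidean_space \<Rightarrow> 'b::real_normed_vector) \<Rightarrow> bool" where
  "Ck 0 f \<longleftrightarrow> continuous_on UNIV f"
| "Ck (Suc k) f \<longleftrightarrow> (\<forall>x. f differentiable (at x)) \<and>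
     (\<forall>v. Ck k (\<lambda>x. frechet_derivative f (at x) v))"

definition torus_periodic :: "('a::euclidean_space \<Rightarrow> 'b) \<Rightarrow> bool" where
  "torus_periodic f \<longleftrightarrow> (\<forall>x. \<forall>b\<in>Basis. f (x + (2 * pi) *\<^sub>R b) = f x)"

definition C_torus :: "nat \<Rightarrow> ('a::euclidean_space \<Rightarrow> 'b::real_normed_vector) set" where
  "C_torus k = {f. Ck k f \<and> torus_periodic f}"

definition V_pair :: "(real ^ 'n \<Rightarrow> real ^ 'n) set" where
  "V_pair = {F. F \<in> C_torus 2 \<and>
     (\<forall>i. \<exists>G :: 'n \<Rightarrow> real \<times> real \<Rightarrow> real.
        (\<forall>j. G j \<in> C_torus 2) \<and> (\<forall>\<theta>. F \<theta> $ i = (\<Sum>j\<in>UNIV. G j (\<theta> $ i, \<theta> $ j))))}"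

definition adaptive_field ::
  "real ^ 'n \<Rightarrow> (real \<Rightarrow> real) \<Rightarrow> (real \<times> real \<Rightarrow> real) \<Rightarrow> real
    \<Rightarrow> (real ^ 'n) \<times> (real ^ 'n ^ 'n) \<Rightarrow> (real ^ 'n) \<times> (real ^ 'n ^ 'n)" where
  "adaptive_field \<omega> \<Gamma> H \<epsilon> = (\<lambda>(\<theta>, A).
     (\<chi> i. \<omega> $ i + (1 / real CARD('n)) * (\<Sum>j\<in>UNIV. A $ i $ j * \<Gamma> (\<theta> $ j - \<theta> $ i)),
      \<chi> i j. (- (A $ i $ j) + H (\<theta> $ i, \<theta> $ j)) / \<epsilon>))"

text \<open>
  Local invariance in the sense of Fenichel: for some neighbourhood \<open>V\<close> of \<open>M\<close>, a trajectory of
  \<open>x' = X x\<close> starting in \<open>M\<close> cannot leave \<open>M\<close>, forwards or backwards in time, without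
  leaving \<open>V\<close>. It is applied on the cover, where a neighbourhood on the torus lifts to such a \<open>V\<close>.
\<close>

definition locally_invariant :: "('p::real_normed_vector \<Rightarrow> 'p) \<Rightarrow> 'p set \<Rightarrow> bool" where
  "locally_invariant X M \<longleftrightarrow> (\<exists>V. open V \<and> M \<subseteq> V \<and>
     (\<forall>x a b. a \<le> 0 \<longrightarrow> 0 \<le> b \<longrightarrow> x 0 \<in> M \<longrightarrow>
        (\<forall>t\<in>{a..b}. (x has_vector_derivative X (x t)) (at t within {a..b}) \<and> x t \<in> V) \<longrightarrow>
        (\<forall>t\<in>{a..b}. x t \<in> M)))"

definition h_crit :: "(real \<times> real \<Rightarrow> real) \<Rightarrow> real ^ 'n \<Rightarrow> real ^ 'n ^ 'n" where
  "h_crit H \<theta> = (\<chi> i j. H (\<theta> $ i, \<theta> $ j))"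

text \<open>
  The closeness of the graphs of \<open>h \<epsilon>\<close> and \<open>h_crit H\<close> is measured in the uniform norm, with a
  constant \<open>C\<close> independent of \<open>\<epsilon>\<close>. The map \<open>h \<epsilon>\<close> is unconstrained for large or nonpositive \<open>\<epsilon>\<close>.
\<close>

definition slow_manifold_family ::
  "real ^ 'n \<Rightarrow> (real \<Rightarrow> real) \<Rightarrow> (real \<times> real \<Rightarrow> real)
    \<Rightarrow> (real \<Rightarrow> real ^ 'n \<Rightarrow> real ^ 'n ^ 'n) \<Rightarrow> bool" where
  "slow_manifold_family \<omega> \<Gamma> H h \<longleftrightarrow> (\<exists>C. \<forall>\<^sub>F \<epsilon> in at_right 0.
     h \<epsilon> \<in> C_torus 3 \<and>
     locally_invariant (adaptive_field \<omega> \<Gamma> H \<epsilon>) (range (\<lambda>\<theta>. (\<theta>, h \<epsilon> \<theta>))) \<and>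
     (\<forall>\<theta>. norm (h \<epsilon> \<theta> - h_crit H \<theta>) \<le> C * \<epsilon>))"

definition reduced_field ::
  "real ^ 'n \<Rightarrow> (real \<Rightarrow> real) \<Rightarrow> (real ^ 'n \<Rightarrow> real ^ 'n ^ 'n) \<Rightarrow> real ^ 'n \<Rightarrow> real ^ 'n" where
  "reduced_field \<omega> \<Gamma> g \<theta> =
     (\<chi> i. \<omega> $ i + (1 / real CARD('n)) * (\<Sum>j\<in>UNIV. g \<theta> $ i $ j * \<Gamma> (\<theta> $ j - \<theta> $ i)))"

definition D1 :: "(real \<times> real \<Rightarrow> real) \<Rightarrow> real \<times> real \<Rightarrow> real" where
  "D1 H = (\<lambda>(u, v). deriv (\<lambda>x. H (x, v)) u)"

definition D2 :: "(real \<times> real \<Rightarrow> real) \<Rightarrow> real \<times> real \<Rightarrow> real" where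
  "D2 H = (\<lambda>(u, v). deriv (\<lambda>y. H (u, y)) v)"

definition partial_deriv :: "'n::finite \<Rightarrow> (real ^ 'n \<Rightarrow> real) \<Rightarrow> real ^ 'n \<Rightarrow> real" where
  "partial_deriv j f \<theta> = deriv (\<lambda>t. f (\<theta> + t *\<^sub>R axis j 1)) 0"

definition T_term ::
  "(real \<Rightarrow> real) \<Rightarrow> (real \<times> real \<Rightarrow> real) \<Rightarrow> 'n \<Rightarrow> 'n \<Rightarrow> 'n \<Rightarrow> real ^ 'n \<Rightarrow> real" where
  "T_term \<Gamma> H i r s \<theta> =
     - \<Gamma> (\<theta> $ r - \<theta> $ i) * D1 H (\<theta> $ i, \<theta> $ r) * H (\<theta> $ i, \<theta> $ s) * \<Gamma> (\<theta> $ s - \<theta> $ i)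
     - \<Gamma> (\<theta> $ r - \<theta> $ i) * D2 H (\<theta> $ i, \<theta> $ r) * H (\<theta> $ r, \<theta> $ s) * \<Gamma> (\<theta> $ s - \<theta> $ r)"

end

theory Submission
  imports Defs
begin

text \<open>
  Closeness of the slow manifold to the critical one is only known in the uniform norm, so no
  derivative of \<open>h \<epsilon>\<close> may be expanded in \<open>\<epsilon>\<close>. Local invariance makes the graph tangent to the field,
  \<open>\<epsilon> * Dh\<^sub>\<epsilon> F\<^sup>\<epsilon> = h\<^sub>0 - h\<^sub>\<epsilon>\<close>. Put \<open>e = h\<^sub>\<epsilon> - h\<^sub>0 + \<epsilon> * Dh\<^sub>0 F\<^sup>0\<close>; this equation gives
  \<open>e = O(\<epsilon>\<^sup>2)\<close> at every critical point of a component of \<open>e\<close>, hence at its extrema on the torus, hence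
  everywhere. So \<open>F\<^sup>\<epsilon>\<^sub>i\<close> equals a pairwise function plus \<open>\<epsilon> / N\<^sup>2\<close> times the sum of the \<open>T\<^sub>i\<^sub>r\<^sub>s\<close> plus \<open>O(\<epsilon>\<^sup>2)\<close>
  uniformly. Mixed second differences in the coordinates \<open>j\<close> and \<open>k\<close> annihilate pairwise functions,
  whereas some mixed difference of the sum at \<open>\<theta>\<^sup>*\<close> is nonzero because its mixed derivative is.
\<close>

section \<open>Bounded Lipschitz functions\<close>

text \<open>Boundedness accompanies the Lipschitz condition so that the class is closed under
  products; the components of the adaptive field are built from such functions by sums and
  products.\<close>

definition bounded_lipschitz_on :: "'a::metric_space set \<Rightarrow> ('a \<Rightarrow> real) \<Rightarrow> bool" where
  "bounded_lipschitz_on S f \<longleftrightarrow> (\<exists>B. \<forall>x\<in>S. \<bar>f x\<bar> \<le> B) \<and> (\<exists>L. L-lipschitz_on S f)"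

lemma bounded_lipschitz_on_const: "bounded_lipschitz_on S (\<lambda>x. c)"
  unfolding bounded_lipschitz_on_def using lipschitz_on_constant by blast

lemma bounded_lipschitz_on_add:
  assumes "bounded_lipschitz_on S f" "bounded_lipschitz_on S g"
  shows "bounded_lipschitz_on S (\<lambda>x. f x + g x)"
proof -
  obtain B C L M where *: "\<And>x. x \<in> S \<Longrightarrow> \<bar>f x\<bar> \<le> B" "\<And>x. x \<in> S \<Longrightarrow> \<bar>g x\<bar> \<le> C"
    and l: "L-lipschitz_on S f" "M-lipschitz_on S g"
    using assms unfolding bounded_lipschitz_on_def by blast
  have "\<bar>f x + g x\<bar> \<le> B + C" if "x \<in> S" for x
    using *[OF that] by linarith
  then show ?thesis
    unfolding bounded_lipschitz_on_def using lipschitz_on_add[OF l] by blast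
qed

lemma bounded_lipschitz_on_mult:
  assumes "bounded_lipschitz_on S f" "bounded_lipschitz_on S g"
  shows "bounded_lipschitz_on S (\<lambda>x. f x * g x)"
\<comment> \<open>On the empty set the bounds \<open>B\<close> and \<open>C\<close> may be negative,
  so their signs are deduced for nonempty \<open>S\<close> only.\<close>
proof (cases "S = {}")
  case True
  then show ?thesis
    unfolding bounded_lipschitz_on_def by auto
next
  case False
  obtain B C L M where *: "\<And>x. x \<in> S \<Longrightarrow> \<bar>f x\<bar> \<le> B" "\<And>x. x \<in> S \<Longrightarrow> \<bar>g x\<bar> \<le> C"
    and l: "L-lipschitz_on S f" "M-lipschitz_on S g"
    using assms unfolding bounded_lipschitz_on_def by blast
  have LM: "0 \<le> L" "0 \<le> M" using l lipschitz_on_nonneg by blast+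
  have BC: "0 \<le> B" "0 \<le> C" using * False by fastforce+
  have "\<bar>f x * g x\<bar> \<le> B * C" if "x \<in> S" for x
    using *[OF that] BC by (simp add: abs_mult mult_mono)
  moreover have "(B * M + L * C)-lipschitz_on S (\<lambda>x. f x * g x)"
  proof (rule lipschitz_onI)
    fix x y assume xy: "x \<in> S" "y \<in> S"
    have "f x * g x - f y * g y = f x * (g x - g y) + (f x - f y) * g y"
      by (simp add: algebra_simps)
    then have "dist (f x * g x) (f y * g y) \<le> \<bar>f x\<bar> * dist (g x) (g y) + dist (f x) (f y) * \<bar>g y\<bar>"
      by (metis abs_mult abs_triangle_ineq dist_real_def)
    also have "\<dots> \<le> B * (M * dist x y) + (L * dist x y) * C"
      using *[OF xy(1)] *[OF xy(2)] lipschitz_onD[OF l(1) xy] lipschitz_onD[OF l(2) xy] BC LM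
      by (intro add_mono mult_mono) auto
    finally show "dist (f x * g x) (f y * g y) \<le> (B * M + L * C) * dist x y"
      by (simp add: algebra_simps)
  qed (use BC LM in auto)
  ultimately show ?thesis
    unfolding bounded_lipschitz_on_def by blast
qed

lemma bounded_lipschitz_on_sum:
  assumes "\<And>i. i \<in> I \<Longrightarrow> bounded_lipschitz_on S (f i)"
  shows "bounded_lipschitz_on S (\<lambda>x. \<Sum>i\<in>I. f i x)"
  using assms
  by (induction I rule: infinite_finite_induct)
    (auto intro: bounded_lipschitz_on_const bounded_lipschitz_on_add)

lemma bounded_lipschitz_on_compose:
  assumes "bounded_lipschitz_on UNIV f" "bounded_linear g"
  shows "bounded_lipschitz_on S (\<lambda>x. f (g x))"
proof -
  obtain B L where *: "\<And>x. \<bar>f x\<bar> \<le> B" and l: "L-lipschitz_on UNIV f"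
    using assms unfolding bounded_lipschitz_on_def by blast
  obtain M where "M-lipschitz_on S g"
    using bounded_linear.lipschitz_boundE[OF assms(2)] by blast
  then have "(L * M)-lipschitz_on S (\<lambda>x. f (g x))"
    by (rule lipschitz_on_compose2) (use l in \<open>auto intro: lipschitz_on_subset\<close>)
  with * show ?thesis
    unfolding bounded_lipschitz_on_def by blast
qed

text \<open>A nonzero linear coordinate is unbounded on the whole space; on a bounded set the
  weights enter the class, which makes the adaptive field Lipschitz on every ball.\<close>

lemma bounded_lipschitz_on_bounded_linear:
  assumes "bounded_linear g" "bounded S"
  shows "bounded_lipschitz_on S g"
proof -
  have "bounded (g ` S)"
    using assms bounded_linear_image by blast
  then have "\<exists>B. \<forall>x\<in>S. \<bar>g x\<bar> \<le> B"
    by (auto simp: bounded_iff)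
  moreover obtain M where "M-lipschitz_on S g"
    using bounded_linear.lipschitz_boundE[OF assms(1)] by blast
  ultimately show ?thesis
    unfolding bounded_lipschitz_on_def by blast
qed

text \<open>The norm is at most the sum of the absolute values of the components, so the component
  constants can be added up.\<close>

lemma lipschitz_on_componentwise:
  fixes f :: "'a::metric_space \<Rightarrow> 'b::euclidean_space"
  assumes "\<And>b. b \<in> Basis \<Longrightarrow> \<exists>L. L-lipschitz_on S (\<lambda>x. f x \<bullet> b)"
  shows "\<exists>L. L-lipschitz_on S f"
proof -
  obtain L where L: "\<And>b. b \<in> Basis \<Longrightarrow> (L b)-lipschitz_on S (\<lambda>x. f x \<bullet> b)"
    using assms by metis
  have "(\<Sum>b\<in>Basis. L b)-lipschitz_on S f"
  proof (rule lipschitz_onI)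
    show "0 \<le> (\<Sum>b\<in>Basis. L b)"
      using L lipschitz_on_nonneg by (intro sum_nonneg) blast
    fix x y assume xy: "x \<in> S" "y \<in> S"
    have "dist (f x) (f y) \<le> (\<Sum>b\<in>Basis. \<bar>(f x - f y) \<bullet> b\<bar>)"
      unfolding dist_norm by (rule norm_le_l1)
    also have "\<dots> \<le> (\<Sum>b\<in>Basis. L b * dist x y)"
      using lipschitz_onD[OF L xy] by (intro sum_mono) (auto simp: dist_real_def inner_diff_left)
    finally show "dist (f x) (f y) \<le> (\<Sum>b\<in>Basis. L b) * dist x y"
      by (simp add: sum_distrib_right)
  qed
  then show ?thesis ..
qed

text \<open>Difference quotients along \<open>v\<close> are at most \<open>L * norm v\<close> in
  absolute value, and the bound passes to the limit.\<close>

lemma has_derivative_bound_of_lipschitz: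
  fixes f :: "'a::real_normed_vector \<Rightarrow> real"
  assumes "L-lipschitz_on UNIV f" and f': "(f has_derivative f') (at x)"
  shows "\<bar>f' v\<bar> \<le> L * norm v"
proof -
  have "((\<lambda>t. x + t *\<^sub>R v) has_derivative (\<lambda>t. t *\<^sub>R v)) (at 0)"
    by (auto intro!: derivative_eq_intros)
  moreover have "(f has_derivative f') (at (x + 0 *\<^sub>R v))"
    using f' by simp
  ultimately have "((\<lambda>t. f (x + t *\<^sub>R v)) has_derivative (\<lambda>t. f' (t *\<^sub>R v))) (at 0)"
    by (rule has_derivative_compose)
  then have "((\<lambda>t. f (x + t *\<^sub>R v)) has_field_derivative f' v) (at 0)"
    unfolding has_field_derivative_def
    by (simp add: linear_cmul[OF has_derivative_linear[OF f']] mult_commute_abs)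
  then have "((\<lambda>t. (f (x + t *\<^sub>R v) - f x) / t) \<longlongrightarrow> f' v) (at 0)"
    by (simp add: DERIV_def)
  then have "((\<lambda>t. \<bar>(f (x + t *\<^sub>R v) - f x) / t\<bar>) \<longlongrightarrow> \<bar>f' v\<bar>) (at 0)"
    by (rule tendsto_rabs)
  moreover have "\<bar>(f (x + t *\<^sub>R v) - f x) / t\<bar> \<le> L * norm v" if "t \<noteq> 0" for t
    using lipschitz_onD[OF assms(1), of "x + t *\<^sub>R v" x] that
    by (simp add: dist_norm field_simps)
  ultimately show ?thesis
    by (auto intro!: tendsto_upperbound simp: eventually_at_filter)
qed

section \<open>Functions on the torus\<close>

lemma torus_periodic_int:
  assumes "torus_periodic f" "b \<in> Basis"
  shows "f (x + (2 * pi * of_int m) *\<^sub>R b) = f x"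
proof (induction m arbitrary: x rule: int_induct[where k = 0])
  case base
  then show ?case by simp
next
  case (step1 m)
  have "f (x + (2 * pi * of_int (m + 1)) *\<^sub>R b) = f ((x + (2 * pi * of_int m) *\<^sub>R b) + (2 * pi) *\<^sub>R b)"
    by (simp add: algebra_simps)
  then show ?case
    using assms step1 by (simp add: torus_periodic_def)
next
  case (step2 m)
  have "f (x + (2 * pi * of_int m) *\<^sub>R b) = f ((x + (2 * pi * of_int (m - 1)) *\<^sub>R b) + (2 * pi) *\<^sub>R b)"
    by (simp add: algebra_simps)
  then show ?case
    using assms step2 by (simp add: torus_periodic_def)
qed

text \<open>Removing whole periods moves every point into a compact box; on the universal cover this
  takes the place of compactness of the torus.\<close>

lemma torus_periodic_representative:
  fixes f :: "'a::euclidean_space \<Rightarrow> 'b"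
  assumes "torus_periodic f"
  obtains y where "y \<in> cbox 0 ((2 * pi) *\<^sub>R One)" "f y = f x"
proof -
  \<comment> \<open>Periods are added in one coordinate at a time, hence the induction on the set of
    basis vectors already treated.\<close>
  have eq: "f (x + (\<Sum>b\<in>B. (2 * pi * of_int (m b)) *\<^sub>R b)) = f x" if "B \<subseteq> Basis" for B m
    using finite_subset[OF that finite_Basis] that
  proof (induction B rule: finite_induct)
    case (insert b B)
    have "f (x + (\<Sum>b\<in>insert b B. (2 * pi * of_int (m b)) *\<^sub>R b))
      = f ((x + (\<Sum>b\<in>B. (2 * pi * of_int (m b)) *\<^sub>R b)) + (2 * pi * of_int (m b)) *\<^sub>R b)"
      using insert by (simp add: add_ac)
    then show ?case
      using insert torus_periodic_int[OF assms] by simp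
  qed simp
  \<comment> \<open>With the floor removed, each coordinate of \<open>y\<close> is
    \<open>2 * pi\<close> times a fractional part.\<close>
  define m where "m b = - \<lfloor>(x \<bullet> b) / (2 * pi)\<rfloor>" for b
  define y where "y = x + (\<Sum>b\<in>Basis. (2 * pi * of_int (m b)) *\<^sub>R b)"
  have "y \<bullet> b = x \<bullet> b + 2 * pi * of_int (m b)" if "b \<in> Basis" for b
    using that by (simp add: y_def inner_add_left)
  then have "y \<bullet> b = 2 * pi * frac ((x \<bullet> b) / (2 * pi))" if "b \<in> Basis" for b
    using that by (simp add: m_def frac_def algebra_simps)
  then have "y \<in> cbox 0 ((2 * pi) *\<^sub>R One)"
    by (auto simp: mem_box frac_ge_0 less_imp_le[OF frac_lt_1])
  moreover have "f y = f x"
    unfolding y_def by (rule eq) simp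
  ultimately show ?thesis by (rule that)
qed

lemma torus_periodic_attains_sup:
  fixes f :: "'a::euclidean_space \<Rightarrow> real"
  assumes "torus_periodic f" "continuous_on UNIV f"
  obtains y where "\<And>x. f x \<le> f y"
proof -
  have "compact (cbox 0 ((2 * pi) *\<^sub>R One :: 'a))" "cbox 0 ((2 * pi) *\<^sub>R One :: 'a) \<noteq> {}"
    by (auto simp: box_ne_empty)
  then obtain y where "\<And>x. x \<in> cbox 0 ((2 * pi) *\<^sub>R One) \<Longrightarrow> f x \<le> f y"
    using continuous_attains_sup[of "cbox 0 ((2 * pi) *\<^sub>R One)" f] assms(2)
      continuous_on_subset by blast
  then have "f x \<le> f y" for x
    using torus_periodic_representative[OF assms(1), of x] by metis
  then show ?thesis by (rule that)
qed

lemma torus_periodic_bounded: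
  fixes f :: "'a::euclidean_space \<Rightarrow> real"
  assumes "torus_periodic f" "continuous_on UNIV f"
  obtains B where "\<And>x. \<bar>f x\<bar> \<le> B"
proof -
  have "torus_periodic (\<lambda>x. \<bar>f x\<bar>)" "continuous_on UNIV (\<lambda>x. \<bar>f x\<bar>)"
    using assms by (auto simp: torus_periodic_def intro: continuous_intros)
  then show ?thesis
    by (rule torus_periodic_attains_sup) (use that in blast)
qed

lemma Ck_imp_continuous: "Ck k f \<Longrightarrow> continuous_on UNIV f"
  by (cases k) (auto simp: continuous_on_eq_continuous_within intro: differentiable_imp_continuous_within)

lemma C_torus_Suc_has_derivative:
  "f \<in> C_torus (Suc k) \<Longrightarrow> (f has_derivative frechet_derivative f (at x)) (at x)"
  by (simp add: C_torus_def frechet_derivative_works)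

text \<open>Differentiating the identity \<open>f (y + (2 * pi) *\<^sub>R b) = f y\<close> shows
  that the derivative inherits the periods.\<close>

lemma C_torus_frechet_derivative:
  assumes "f \<in> C_torus (Suc k)"
  shows "(\<lambda>x. frechet_derivative f (at x) v) \<in> C_torus k"
proof -
  have f': "(f has_derivative frechet_derivative f (at x)) (at x)" for x
    using assms by (rule C_torus_Suc_has_derivative)
  have "frechet_derivative f (at (x + (2 * pi) *\<^sub>R b)) = frechet_derivative f (at x)"
    if "b \<in> Basis" for x b
  proof -
    have "((\<lambda>y. f (y + (2 * pi) *\<^sub>R b)) has_derivative frechet_derivative f (at (x + (2 * pi) *\<^sub>R b))) (at x)"
      by (rule has_derivative_compose[OF _ f', THEN has_derivative_eq_rhs])
        (auto intro!: derivative_eq_intros)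
    moreover have "(\<lambda>y. f (y + (2 * pi) *\<^sub>R b)) = f"
      using assms that by (auto simp: C_torus_def torus_periodic_def)
    ultimately show ?thesis
      using frechet_derivative_at by fastforce
  qed
  then show ?thesis
    using assms by (auto simp: C_torus_def torus_periodic_def)
qed

text \<open>Directional derivatives are continuous and periodic, hence bounded. Expanding directions
  in the basis bounds the operator norm of the derivative, and the mean value inequality gives the
  Lipschitz constant.\<close>

lemma C_torus_bounded_lipschitz:
  fixes f :: "'a::euclidean_space \<Rightarrow> real"
  assumes "f \<in> C_torus (Suc k)"
  shows "bounded_lipschitz_on UNIV f"
proof -
  let ?D = "\<lambda>x. frechet_derivative f (at x)"
  have f': "(f has_derivative ?D x) (at x)" for x
    using assms by (rule C_torus_Suc_has_derivative)
  have "\<exists>B. \<forall>x. \<bar>?D x b\<bar> \<le> B" for b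
  proof -
    have "torus_periodic (\<lambda>x. ?D x b)" "Ck k (\<lambda>x. ?D x b)"
      using C_torus_frechet_derivative[OF assms, of b] by (simp_all add: C_torus_def)
    then show ?thesis
      by (meson torus_periodic_bounded Ck_imp_continuous)
  qed
  then obtain B where B: "\<And>x b. \<bar>?D x b\<bar> \<le> B b" by metis
  have "(\<Sum>b\<in>Basis. B b)-lipschitz_on UNIV f"
  proof (rule bounded_derivative_imp_lipschitz)
    show "0 \<le> (\<Sum>b\<in>Basis. B b)"
      using B by (intro sum_nonneg) (meson abs_ge_zero order_trans)
    fix x
    have "\<bar>?D x v\<bar> \<le> (\<Sum>b\<in>Basis. B b) * norm v" for v
    proof -
      have "?D x v = ?D x (\<Sum>b\<in>Basis. (v \<bullet> b) *\<^sub>R b)"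
        by (simp add: euclidean_representation)
      also have "\<dots> = (\<Sum>b\<in>Basis. (v \<bullet> b) * ?D x b)"
        by (simp add: linear_sum[OF has_derivative_linear[OF f']]
            linear_cmul[OF has_derivative_linear[OF f']])
      finally have "\<bar>?D x v\<bar> \<le> (\<Sum>b\<in>Basis. \<bar>v \<bullet> b\<bar> * \<bar>?D x b\<bar>)"
        by (simp add: abs_mult[symmetric])
      also have "\<dots> \<le> (\<Sum>b\<in>Basis. norm v * B b)"
        using B by (intro sum_mono mult_mono) (auto simp: Basis_le_norm)
      finally show ?thesis
        by (simp add: sum_distrib_left mult.commute)
    qed
    then show "onorm (?D x) \<le> (\<Sum>b\<in>Basis. B b)"
      by (intro onorm_bound \<open>0 \<le> (\<Sum>b\<in>Basis. B b)\<close>) auto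
  qed (use f' in \<open>auto intro: has_derivative_at_withinI\<close>)
  moreover obtain C where "\<And>x. \<bar>f x\<bar> \<le> C"
    using torus_periodic_bounded assms Ck_imp_continuous unfolding C_torus_def by blast
  ultimately show ?thesis
    unfolding bounded_lipschitz_on_def by blast
qed

section \<open>Local solutions and tangency of invariant graphs\<close>

text \<open>Local invariance only constrains trajectories that are given, so a trajectory through a
  prescribed point has to be produced first. It is the fixed point of Picard's integral
  operator.\<close>

lemma picard_local_solution:
  fixes X :: "'a::euclidean_space \<Rightarrow> 'a"
  assumes lip: "L-lipschitz_on (cball p r) X" and r: "0 < r"
  obtains b x where "0 < b" "x 0 = p"
    "\<And>t. t \<in> {0..b} \<Longrightarrow> (x has_vector_derivative X (x t)) (at t within {0..b})"
    "\<And>t. t \<in> {0..b} \<Longrightarrow> x t \<in> cball p r"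
proof -
  \<comment> \<open>Composing with the nearest-point retraction onto the ball makes the field globally Lipschitz
    and bounded, so that Picard's operator acts on all bounded continuous functions.\<close>
  define Y where "Y = X \<circ> closest_point (cball p r)"
  have ball: "convex (cball p r)" "closed (cball p r)" "cball p r \<noteq> {}"
    using r by auto
  have in_ball: "closest_point (cball p r) x \<in> cball p r" for x
    using ball by (intro closest_point_in_set) auto
  have L: "0 \<le> L" using lip by (rule lipschitz_on_nonneg)
  have Y_lip: "dist (Y x) (Y y) \<le> L * dist x y" for x y
  proof -
    have "dist (Y x) (Y y) \<le> L * dist (closest_point (cball p r) x) (closest_point (cball p r) y)"
      unfolding Y_def o_def by (intro lipschitz_onD[OF lip] in_ball)
    also have "\<dots> \<le> L * dist x y"
      using closest_point_lipschitz[OF ball] L by (intro mult_left_mono)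
    finally show ?thesis .
  qed
  have Y_cont: "continuous_on UNIV Y"
    by (rule lipschitz_on_continuous_on[of L]) (use Y_lip L in \<open>auto intro: lipschitz_onI\<close>)
  have "compact (X ` cball p r)"
    using lip by (intro compact_continuous_image lipschitz_on_continuous_on) auto
  then obtain M where M: "\<And>x. x \<in> cball p r \<Longrightarrow> norm (X x) \<le> M"
    by (meson bounded_iff compact_imp_bounded imageI)
  have Y_bound: "norm (Y x) \<le> M" for x
    unfolding Y_def o_def by (intro M in_ball)
  have M0: "0 \<le> M" using Y_bound[of p] norm_ge_zero order_trans by blast
  \<comment> \<open>The first bound makes Picard's operator a contraction with factor 1/2, the
    second keeps its values within distance \<open>r\<close> of \<open>p\<close>. Adding 1 keeps the
    denominators positive when \<open>L\<close> or \<open>M\<close> is zero.\<close>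
  define b where "b = min (1 / (2 * (L + 1))) (r / (M + 1))"
  have b: "0 < b" "b * L \<le> 1 / 2" "b * M \<le> r"
  proof -
    show "0 < b" using L M0 r by (simp add: b_def)
    have "b * L \<le> 1 / (2 * (L + 1)) * L"
      using L unfolding b_def by (intro mult_right_mono) auto
    also have "\<dots> \<le> 1 / 2" using L by (simp add: field_simps)
    finally show "b * L \<le> 1 / 2" .
    have "b * M \<le> r / (M + 1) * M"
      using M0 unfolding b_def by (intro mult_right_mono) auto
    also have "\<dots> \<le> r" using M0 r by (simp add: field_simps)
    finally show "b * M \<le> r" .
  qed
  \<comment> \<open>Freezing time outside \<open>{0..b}\<close> extends Picard's operator to
    functions on the whole line, so that it acts on the complete space of bounded continuous
    functions.\<close>
  define clamp where "clamp t = max 0 (min b t)" for t :: real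
  have clamp: "clamp t \<in> {0..b}" for t
    using b by (auto simp: clamp_def)
  have clamp_id: "clamp t = t" if "t \<in> {0..b}" for t
    using that by (auto simp: clamp_def)
  define P where "P f = (\<lambda>t. p + integral {0..clamp t} (\<lambda>s. Y (apply_bcontfun f s)))"
    for f :: "real \<Rightarrow>\<^sub>C 'a"
  have Yf_cont: "continuous_on S (\<lambda>s. Y (apply_bcontfun f s))" for f :: "real \<Rightarrow>\<^sub>C 'a" and S
    by (rule continuous_on_compose2[OF Y_cont]) auto
  have Yf_int: "(\<lambda>s. Y (apply_bcontfun f s)) integrable_on {c..d}"
    for f :: "real \<Rightarrow>\<^sub>C 'a" and c d
    by (intro integrable_continuous_real Yf_cont)
  have P_bound: "norm (P f t - p) \<le> b * M" for f t
  proof -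
    have "norm (integral {0..clamp t} (\<lambda>s. Y (apply_bcontfun f s))) \<le> M * (clamp t - 0)"
      using clamp[of t] by (intro integral_bound Yf_cont Y_bound) auto
    also have "\<dots> \<le> b * M"
      using clamp[of t] M0 mult_right_mono by (fastforce simp: mult.commute)
    finally show ?thesis by (simp add: P_def)
  qed
  have P_in: "P f \<in> bcontfun" for f
  proof -
    have "continuous_on UNIV (\<lambda>t. integral {0..clamp t} (\<lambda>s. Y (apply_bcontfun f s)))"
    proof (rule continuous_on_compose2[of "{0..b}"])
      show "continuous_on {0..b} (\<lambda>x. integral {0..x} (\<lambda>s. Y (apply_bcontfun f s)))"
        by (intro indefinite_integral_continuous_1 Yf_int)
      show "continuous_on UNIV clamp"
        unfolding clamp_def by (intro continuous_intros)
    qed (use clamp in auto)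
    moreover have "norm (P f t) \<le> norm p + b * M" for t
      using P_bound[of f t] norm_triangle_sub[of "P f t" p] by linarith
    ultimately show ?thesis
      unfolding bcontfun_def P_def by (auto intro!: continuous_intros boundedI)
  qed
  define Q where "Q f = Bcontfun (P f)" for f
  have Q: "apply_bcontfun (Q f) = P f" for f
    unfolding Q_def using P_in by (rule Bcontfun_inverse)
  have "\<forall>f g. dist (Q f) (Q g) \<le> (1 / 2) * dist f g"
  proof (intro allI dist_bound)
    fix f g t
    have "dist (Q f t) (Q g t)
      = norm (integral {0..clamp t} (\<lambda>s. Y (apply_bcontfun f s) - Y (apply_bcontfun g s)))"
      by (simp add: Q P_def dist_norm integral_diff[OF Yf_int Yf_int])
    also have "\<dots> \<le> (L * dist f g) * (clamp t - 0)"
    proof (rule integral_bound)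
      show "norm (Y (apply_bcontfun f s) - Y (apply_bcontfun g s)) \<le> L * dist f g" for s
        using Y_lip[of "f s" "g s"] mult_left_mono[OF dist_bounded[of f s g] L]
        by (simp add: dist_norm)
    qed (use clamp[of t] in \<open>auto intro!: continuous_intros Yf_cont\<close>)
    also have "\<dots> \<le> (L * dist f g) * b"
      using clamp[of t] L by (intro mult_left_mono) auto
    also have "\<dots> \<le> 1 / 2 * dist f g"
      using mult_right_mono[OF b(2), of "dist f g"] by (simp add: mult_ac)
    finally show "dist (Q f t) (Q g t) \<le> 1 / 2 * dist f g" .
  qed
  then obtain f where "Q f = f"
    using banach_fix_type[of "1 / 2" Q] by auto
  then have f: "apply_bcontfun f = P f"
    using Q by metis
  have f_at: "apply_bcontfun f t = p + integral {0..clamp t} (\<lambda>s. Y (apply_bcontfun f s))" for t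
    using fun_cong[OF f, of t] unfolding P_def .
  have f_ball: "apply_bcontfun f t \<in> cball p r" for t
    using P_bound[of f t] b unfolding f by (simp add: dist_norm norm_minus_commute)
  \<comment> \<open>The fixed point stays in the ball, where the retraction is the identity, so it
    solves the equation for \<open>X\<close> itself.\<close>
  have Yf: "Y (apply_bcontfun f t) = X (apply_bcontfun f t)" for t
    unfolding Y_def using closest_point_self[OF f_ball] by simp
  show ?thesis
  proof (rule that[of b "apply_bcontfun f"])
    show "apply_bcontfun f 0 = p"
      using f_at[of 0] clamp_id[of 0] b by simp
    fix t assume t: "t \<in> {0..b}"
    have "((\<lambda>u. p + integral {0..u} (\<lambda>s. Y (apply_bcontfun f s)))
        has_vector_derivative Y (apply_bcontfun f t)) (at t within {0..b})"
      using integral_has_vector_derivative[OF Yf_cont t]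
      by (auto intro!: derivative_eq_intros)
    then show "(apply_bcontfun f has_vector_derivative X (apply_bcontfun f t)) (at t within {0..b})"
      unfolding Yf[symmetric]
      by (rule has_vector_derivative_transform[OF t, rotated]) (subst f_at, simp add: clamp_id)
  qed (use b f_ball in auto)
qed

text \<open>A trajectory starting on the graph remains there for a short time, so its second
  component is \<open>h\<close> of its first. Differentiating this relation at time 0 gives the
  tangency.\<close>

lemma locally_invariant_graph_tangent:
  fixes h :: "'a::euclidean_space \<Rightarrow> 'b::euclidean_space"
  assumes lip: "\<And>p r. \<exists>L. L-lipschitz_on (cball p r) X"
    and inv: "locally_invariant X (range (\<lambda>\<theta>. (\<theta>, h \<theta>)))"
    and h': "(h has_derivative h') (at \<theta>)"
  shows "h' (fst (X (\<theta>, h \<theta>))) = snd (X (\<theta>, h \<theta>))"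
proof -
  let ?M = "range (\<lambda>\<theta>. (\<theta>, h \<theta>))" and ?p = "(\<theta>, h \<theta>)"
  obtain V where V: "open V" "?M \<subseteq> V"
    and stay: "\<forall>x a b. a \<le> 0 \<longrightarrow> 0 \<le> b \<longrightarrow> x 0 \<in> ?M \<longrightarrow>
        (\<forall>t\<in>{a..b}. (x has_vector_derivative X (x t)) (at t within {a..b}) \<and> x t \<in> V) \<longrightarrow>
        (\<forall>t\<in>{a..b}. x t \<in> ?M)"
    using inv unfolding locally_invariant_def by (elim exE conjE) (rule that)
  \<comment> \<open>The ball fits inside the neighbourhood \<open>V\<close>, so the trajectory built
    in it cannot use the escape clause of local invariance.\<close>
  obtain r where r: "0 < r" "cball ?p r \<subseteq> V"
    using V open_contains_cball by (metis rangeI subsetD)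
  obtain L where "L-lipschitz_on (cball ?p r) X"
    using lip by blast
  then obtain b x where b: "0 < b" and x0: "x 0 = ?p"
    and x': "\<And>t. t \<in> {0..b} \<Longrightarrow> (x has_vector_derivative X (x t)) (at t within {0..b})"
    and x: "\<And>t. t \<in> {0..b} \<Longrightarrow> x t \<in> cball ?p r"
    using picard_local_solution[OF _ r(1)] by metis
  have "\<forall>t\<in>{0..b}. (x has_vector_derivative X (x t)) (at t within {0..b}) \<and> x t \<in> V"
    using x' x r by blast
  with stay[THEN spec[where x = x], THEN spec[where x = 0], THEN spec[where x = b]]
  have "\<forall>t\<in>{0..b}. x t \<in> ?M"
    using b x0 by simp
  then have graph: "snd (x t) = h (fst (x t))" if "t \<in> {0..b}" for t
    using that by fastforce
  have d: "(x has_vector_derivative X ?p) (at 0 within {0..b})"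
    using x'[of 0] b x0 by simp
  have d_fst: "((\<lambda>t. fst (x t)) has_vector_derivative fst (X ?p)) (at 0 within {0..b})"
    by (rule bounded_linear.has_vector_derivative[OF bounded_linear_fst d])
  have "(h has_derivative h') (at (fst (x 0)))"
    using h' x0 by simp
  with d_fst have "((\<lambda>t. h (fst (x t))) has_derivative (\<lambda>t. h' (t *\<^sub>R fst (X ?p)))) (at 0 within {0..b})"
    unfolding has_vector_derivative_def by (rule has_derivative_compose)
  then have "((\<lambda>t. h (fst (x t))) has_vector_derivative h' (fst (X ?p))) (at 0 within {0..b})"
    unfolding has_vector_derivative_def
    by (simp add: linear_cmul[OF has_derivative_linear[OF h']])
  then have 1: "((\<lambda>t. snd (x t)) has_vector_derivative h' (fst (X ?p))) (at 0 within {0..b})"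
    by (rule has_vector_derivative_transform[rotated 2]) (use b graph in auto)
  have 2: "((\<lambda>t. snd (x t)) has_vector_derivative snd (X ?p)) (at 0 within {0..b})"
    by (rule bounded_linear.has_vector_derivative[OF bounded_linear_snd d])
  \<comment> \<open>Both derivatives are one-sided at the endpoint 0; they agree because the
    interval from 0 to \<open>b\<close> is nondegenerate.\<close>
  show ?thesis
    using vector_derivative_unique_within_closed_interval[of 0 b 0 "\<lambda>t. snd (x t)"] 1 2 b
    by (simp add: cbox_interval)
qed

section \<open>Invariance equation of the slow manifold\<close>

lemma adaptive_field_lipschitz:
  fixes \<omega> :: "real ^ 'n"
  assumes \<Gamma>: "bounded_lipschitz_on UNIV \<Gamma>" and H: "bounded_lipschitz_on UNIV H" and S: "bounded S"
  shows "\<exists>L. L-lipschitz_on S (adaptive_field \<omega> \<Gamma> H \<epsilon>)"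
proof (rule lipschitz_on_componentwise)
  have lin: "bounded_linear (\<lambda>x :: (real ^ 'n) \<times> (real ^ 'n ^ 'n). fst x $ i)"
    "bounded_linear (\<lambda>x :: (real ^ 'n) \<times> (real ^ 'n ^ 'n). snd x $ i $ j)" for i j
    by (auto intro!: bounded_linear_intros bounded_linear_compose[OF bounded_linear_vec_nth])
  note bl = bounded_lipschitz_on_add bounded_lipschitz_on_mult bounded_lipschitz_on_sum
    bounded_lipschitz_on_const
  have A: "bounded_lipschitz_on S (\<lambda>x. snd x $ i $ j)" for i j
    using lin S by (intro bounded_lipschitz_on_bounded_linear)
  have G: "bounded_lipschitz_on S (\<lambda>x. \<Gamma> (fst x $ j - fst x $ i))" for i j
    using lin by (intro bounded_lipschitz_on_compose[OF \<Gamma>] bounded_linear_sub)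
  have HH: "bounded_lipschitz_on S (\<lambda>x. H (fst x $ i, fst x $ j))" for i j
    using lin by (intro bounded_lipschitz_on_compose[OF H] bounded_linear_Pair)
  fix b :: "(real ^ 'n) \<times> (real ^ 'n ^ 'n)" assume "b \<in> Basis"
  then consider i where "b = (axis i 1, 0)" | i j where "b = (0, axis i (axis j 1))"
    by (auto simp: Basis_prod_def Basis_vec_def)
  then have "bounded_lipschitz_on S (\<lambda>x. adaptive_field \<omega> \<Gamma> H \<epsilon> x \<bullet> b)"
  proof cases
    case (1 i)
    have "bounded_lipschitz_on S (\<lambda>x. \<omega> $ i + (1 / real CARD('n)) *
        (\<Sum>j\<in>UNIV. snd x $ i $ j * \<Gamma> (fst x $ j - fst x $ i)))"
      by (intro bl A G)
    then show ?thesis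
      by (simp add: 1 adaptive_field_def inner_axis case_prod_unfold)
  next
    case (2 i j)
    have "bounded_lipschitz_on S (\<lambda>x. (1 / \<epsilon>) * ((-1) * snd x $ i $ j + H (fst x $ i, fst x $ j)))"
      by (intro bl A HH)
    then show ?thesis
      by (simp add: 2 adaptive_field_def inner_axis case_prod_unfold)
  qed
  then show "\<exists>L. L-lipschitz_on S (\<lambda>x. adaptive_field \<omega> \<Gamma> H \<epsilon> x \<bullet> b)"
    unfolding bounded_lipschitz_on_def by blast
qed

text \<open>On the graph the phase part of the adaptive field is the reduced field, so this is the
  tangency relation read off in the weight component (i, j).\<close>

lemma slow_manifold_invariance_equation:
  fixes h :: "real ^ 'n \<Rightarrow> real ^ 'n ^ 'n"
  assumes "\<Gamma> \<in> C_torus (Suc k)" "H \<in> C_torus (Suc l)"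
    and inv: "locally_invariant (adaptive_field \<omega> \<Gamma> H \<epsilon>) (range (\<lambda>\<theta>. (\<theta>, h \<theta>)))"
    and h': "(h has_derivative h') (at \<theta>)"
  shows "h' (reduced_field \<omega> \<Gamma> h \<theta>) $ i $ j = (H (\<theta> $ i, \<theta> $ j) - h \<theta> $ i $ j) / \<epsilon>"
proof -
  have "\<exists>L. L-lipschitz_on (cball p r) (adaptive_field \<omega> \<Gamma> H \<epsilon>)" for p r
    using assms by (intro adaptive_field_lipschitz C_torus_bounded_lipschitz) auto
  from locally_invariant_graph_tangent[OF this inv h']
  have "h' (reduced_field \<omega> \<Gamma> h \<theta>) = (\<chi> i j. (- (h \<theta> $ i $ j) + H (\<theta> $ i, \<theta> $ j)) / \<epsilon>)"
    by (simp add: adaptive_field_def reduced_field_def)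
  then show ?thesis by simp
qed

section \<open>Expansion of the slow manifold\<close>

text \<open>A periodic differentiable function attains its maximum and minimum, and both are
  critical points. The bound thus spreads from critical points to the whole torus without any
  control of the derivative elsewhere.\<close>

lemma torus_periodic_le_of_critical:
  fixes e :: "'a::euclidean_space \<Rightarrow> real"
  assumes per: "torus_periodic e"
    and e': "\<And>x. (e has_derivative e' x) (at x)"
    and crit: "\<And>x. e' x = (\<lambda>_. 0) \<Longrightarrow> \<bar>e x\<bar> \<le> M"
  shows "\<bar>e x\<bar> \<le> M"
proof -
  \<comment> \<open>Taking \<open>f\<close> to be \<open>e\<close> or its negative treats the
    maximum and the minimum of \<open>e\<close> together.\<close>
  have le: "f x \<le> M" if f: "f = e \<or> f = (\<lambda>x. - e x)" for f
  proof -
    have "continuous_on UNIV e"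
      using e' has_derivative_continuous_on has_derivative_at_withinI by blast
    then have "torus_periodic f" "continuous_on UNIV f"
      using f per by (auto simp: torus_periodic_def intro: continuous_intros)
    then obtain y where y: "\<And>x. f x \<le> f y"
      using torus_periodic_attains_sup by blast
    have "(\<forall>z\<in>UNIV. e z \<le> e y) \<or> (\<forall>z\<in>UNIV. e y \<le> e z)"
      using f y by auto
    then have "e' y = (\<lambda>_. 0)"
      by (rule differential_zero_maxmin[OF UNIV_I open_UNIV e'])
    then have "f y \<le> M"
      using crit[of y] f by auto
    then show ?thesis
      using y[of x] by linarith
  qed
  show ?thesis
    using le[of e] le[of "\<lambda>x. - e x"] by auto
qed

text \<open>The class collects what the expansion asks of its known coefficients: periodicity for
  the existence of extrema, differentiability to form derivatives there, and a Lipschitz constant to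
  bound them. It is closed under sums and products.\<close>

definition torus_lipschitz :: "('a::euclidean_space \<Rightarrow> real) \<Rightarrow> bool" where
  "torus_lipschitz f \<longleftrightarrow>
     torus_periodic f \<and> (\<forall>x. f differentiable (at x)) \<and> bounded_lipschitz_on UNIV f"

lemma torus_lipschitz_C_torus: "f \<in> C_torus (Suc k) \<Longrightarrow> torus_lipschitz f"
  unfolding torus_lipschitz_def using C_torus_bounded_lipschitz by (auto simp: C_torus_def)

lemma torus_lipschitz_const: "torus_lipschitz (\<lambda>x. c)"
  by (simp add: torus_lipschitz_def torus_periodic_def bounded_lipschitz_on_const)

lemma torus_lipschitz_add:
  "torus_lipschitz f \<Longrightarrow> torus_lipschitz g \<Longrightarrow> torus_lipschitz (\<lambda>x. f x + g x)"
  by (auto simp: torus_lipschitz_def torus_periodic_def intro: bounded_lipschitz_on_add)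

lemma torus_lipschitz_mult:
  "torus_lipschitz f \<Longrightarrow> torus_lipschitz g \<Longrightarrow> torus_lipschitz (\<lambda>x. f x * g x)"
  by (auto simp: torus_lipschitz_def torus_periodic_def intro: bounded_lipschitz_on_mult)

lemma torus_lipschitz_sum:
  "(\<And>i. i \<in> I \<Longrightarrow> torus_lipschitz (f i)) \<Longrightarrow> torus_lipschitz (\<lambda>x. \<Sum>i\<in>I. f i x)"
  by (induction I rule: infinite_finite_induct)
    (auto intro: torus_lipschitz_const torus_lipschitz_add)

lemma torus_lipschitz_pair:
  assumes "torus_lipschitz f"
  shows "torus_lipschitz (\<lambda>\<theta> :: real ^ 'n. f (\<theta> $ i, \<theta> $ j))"
proof -
  have lin: "bounded_linear (\<lambda>\<theta> :: real ^ 'n. (\<theta> $ i, \<theta> $ j))"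
    by (intro bounded_linear_Pair bounded_linear_vec_nth)
  have per: "f (u + 2 * pi, v) = f (u, v)" "f (u, v + 2 * pi) = f (u, v)" for u v
  proof -
    have *: "\<And>x b. b \<in> Basis \<Longrightarrow> f (x + (2 * pi) *\<^sub>R b) = f x"
      using assms unfolding torus_lipschitz_def torus_periodic_def by blast
    show "f (u + 2 * pi, v) = f (u, v)"
      using *[of "(1, 0)" "(u, v)"] by (simp add: Basis_prod_def)
    show "f (u, v + 2 * pi) = f (u, v)"
      using *[of "(0, 1)" "(u, v)"] by (simp add: Basis_prod_def)
  qed
  have "f ((\<theta> + (2 * pi) *\<^sub>R axis k 1) $ i, (\<theta> + (2 * pi) *\<^sub>R axis k 1) $ j) = f (\<theta> $ i, \<theta> $ j)"
    for \<theta> k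
    \<comment> \<open>A shift in coordinate \<open>k\<close> moves the first argument, the second,
      both or neither, according to which of \<open>i\<close> and \<open>j\<close> equal
      \<open>k\<close>.\<close>
    by (cases "i = k"; cases "j = k") (auto simp: axis_def per)
  then have "torus_periodic (\<lambda>\<theta> :: real ^ 'n. f (\<theta> $ i, \<theta> $ j))"
    unfolding torus_periodic_def by (auto simp: Basis_vec_def)
  moreover have "(\<lambda>\<theta> :: real ^ 'n. f (\<theta> $ i, \<theta> $ j)) differentiable (at \<theta>)" for \<theta>
    using assms bounded_linear_imp_differentiable[OF lin, of "at \<theta>"] unfolding torus_lipschitz_def
    by (intro differentiable_compose[of f "\<lambda>\<theta>. (\<theta> $ i, \<theta> $ j)"]) auto
  ultimately show ?thesis
    using assms bounded_lipschitz_on_compose[OF _ lin] unfolding torus_lipschitz_def by auto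
qed

lemma torus_lipschitz_diff:
  assumes "torus_lipschitz f"
  shows "torus_lipschitz (\<lambda>\<theta> :: real ^ 'n. f (\<theta> $ j - \<theta> $ i))"
proof -
  have lin: "bounded_linear (\<lambda>\<theta> :: real ^ 'n. \<theta> $ j - \<theta> $ i)"
    by (intro bounded_linear_sub bounded_linear_vec_nth)
  have per: "f (u + 2 * pi) = f u" for u
    using assms unfolding torus_lipschitz_def torus_periodic_def by auto
  \<comment> \<open>A shift in coordinate \<open>i\<close> lowers the difference by a period, so
    periodicity is also used backwards.\<close>
  then have per': "f (u - 2 * pi) = f u" for u
    by (metis diff_add_cancel)
  have "f ((\<theta> + (2 * pi) *\<^sub>R axis k 1) $ j - (\<theta> + (2 * pi) *\<^sub>R axis k 1) $ i) = f (\<theta> $ j - \<theta> $ i)"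
    for \<theta> k
    using per[of "\<theta> $ j - \<theta> $ i"] per'[of "\<theta> $ j - \<theta> $ i"]
    by (cases "i = k"; cases "j = k") (auto simp: axis_def algebra_simps)
  then have "torus_periodic (\<lambda>\<theta> :: real ^ 'n. f (\<theta> $ j - \<theta> $ i))"
    unfolding torus_periodic_def by (auto simp: Basis_vec_def)
  moreover have "(\<lambda>\<theta> :: real ^ 'n. f (\<theta> $ j - \<theta> $ i)) differentiable (at \<theta>)" for \<theta>
    using assms bounded_linear_imp_differentiable[OF lin, of "at \<theta>"] unfolding torus_lipschitz_def
    by (intro differentiable_compose[of f "\<lambda>\<theta>. \<theta> $ j - \<theta> $ i"]) auto
  ultimately show ?thesis
    using assms bounded_lipschitz_on_compose[OF _ lin] unfolding torus_lipschitz_def by auto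
qed

section \<open>Partial derivatives of the coupling function\<close>

lemma D1_D2_frechet_derivative:
  assumes "H differentiable (at x)"
  shows "D1 H x = frechet_derivative H (at x) (1, 0)" "D2 H x = frechet_derivative H (at x) (0, 1)"
proof -
  obtain u v where x: "x = (u, v)" by fastforce
  have H': "(H has_derivative frechet_derivative H (at (u, v))) (at (u, v))"
    using assms x frechet_derivative_works by blast
  note cmul = linear_cmul[OF has_derivative_linear[OF H']]
  have lin: "t * frechet_derivative H (at (u, v)) (1, 0) = frechet_derivative H (at (u, v)) (t, 0)"
    "t * frechet_derivative H (at (u, v)) (0, 1) = frechet_derivative H (at (u, v)) (0, t)" for t
    using cmul[of t "(1, 0)"] cmul[of t "(0, 1)"] by simp_all
  have "((\<lambda>t. (t, v)) has_derivative (\<lambda>t. (t, 0))) (at u)"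
    by (auto intro!: derivative_eq_intros)
  from has_derivative_compose[OF this H']
  have "((\<lambda>t. H (t, v)) has_derivative (\<lambda>t. frechet_derivative H (at (u, v)) (t, 0))) (at u)" .
  then have "((\<lambda>t. H (t, v)) has_field_derivative frechet_derivative H (at (u, v)) (1, 0)) (at u)"
    by (rule has_derivative_imp_has_field_derivative) (rule lin)
  then show "D1 H x = frechet_derivative H (at x) (1, 0)"
    by (simp add: D1_def x DERIV_imp_deriv)
  have "((\<lambda>t. (u, t)) has_derivative (\<lambda>t. (0, t))) (at v)"
    by (auto intro!: derivative_eq_intros)
  from has_derivative_compose[OF this H']
  have "((\<lambda>t. H (u, t)) has_derivative (\<lambda>t. frechet_derivative H (at (u, v)) (0, t))) (at v)" .
  then have "((\<lambda>t. H (u, t)) has_field_derivative frechet_derivative H (at (u, v)) (0, 1)) (at v)"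
    by (rule has_derivative_imp_has_field_derivative) (rule lin)
  then show "D2 H x = frechet_derivative H (at x) (0, 1)"
    by (simp add: D2_def x DERIV_imp_deriv)
qed

lemma frechet_derivative_D1_D2:
  assumes "H differentiable (at x)"
  shows "frechet_derivative H (at x) (a, b) = D1 H x * a + D2 H x * b"
proof -
  let ?H' = "frechet_derivative H (at x)"
  have "linear ?H'"
    using assms by (rule linear_frechet_derivative)
  then have "?H' (a *\<^sub>R (1, 0) + b *\<^sub>R (0, 1)) = a * ?H' (1, 0) + b * ?H' (0, 1)"
    by (simp only: linear_add linear_cmul real_scaleR_def)
  then show ?thesis
    using D1_D2_frechet_derivative[OF assms] by simp
qed

lemma C_torus_D1_D2:
  assumes "H \<in> C_torus (Suc k)"
  shows "D1 H \<in> C_torus k" "D2 H \<in> C_torus k"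
proof -
  have "D1 H = (\<lambda>x. frechet_derivative H (at x) (1, 0))" "D2 H = (\<lambda>x. frechet_derivative H (at x) (0, 1))"
    using assms D1_D2_frechet_derivative by (auto simp: C_torus_def)
  then show "D1 H \<in> C_torus k" "D2 H \<in> C_torus k"
    using C_torus_frechet_derivative[OF assms] by auto
qed

text \<open>Here \<open>q\<close> is the derivative of the critical manifold's component (i, j)
  along the limiting field \<open>F0\<close>. The error of the first-order approximation is
  estimated at its critical points through the invariance equation. The constant is chosen before
  \<epsilon> and \<open>h\<close>, so it is uniform in both.\<close>

lemma slow_manifold_first_order_expansion:
  fixes \<omega> :: "real ^ 'n" and i j :: 'n
  assumes \<Gamma>: "\<Gamma> \<in> C_torus 3" and H: "H \<in> C_torus 3"
  defines "F0 \<equiv> reduced_field \<omega> \<Gamma> (h_crit H)"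
  defines "q \<equiv> \<lambda>\<theta>. D1 H (\<theta> $ i, \<theta> $ j) * F0 \<theta> $ i + D2 H (\<theta> $ i, \<theta> $ j) * F0 \<theta> $ j"
  obtains K where "\<And>\<epsilon> h \<theta>. \<lbrakk>0 < \<epsilon>; \<epsilon> < 1; h \<in> C_torus 3;
      locally_invariant (adaptive_field \<omega> \<Gamma> H \<epsilon>) (range (\<lambda>\<theta>. (\<theta>, h \<theta>)));
      \<And>\<theta>. norm (h \<theta> - h_crit H \<theta>) \<le> C * \<epsilon>\<rbrakk>
    \<Longrightarrow> \<bar>h \<theta> $ i $ j - H (\<theta> $ i, \<theta> $ j) + \<epsilon> * q \<theta>\<bar> \<le> K * \<epsilon>\<^sup>2"
proof -
  define u0 where "u0 \<theta> = H (\<theta> $ i, \<theta> $ j)" for \<theta> :: "real ^ 'n"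
  have Suc: "\<Gamma> \<in> C_torus (Suc 2)" "H \<in> C_torus (Suc 2)"
    using \<Gamma> H by (simp_all add: numeral_3_eq_3 numeral_2_eq_2)
  have "D1 H \<in> C_torus (Suc 1)" "D2 H \<in> C_torus (Suc 1)"
    using C_torus_D1_D2[OF Suc(2)] by (simp_all add: numeral_2_eq_2)
  with Suc have tl: "torus_lipschitz \<Gamma>" "torus_lipschitz H" "torus_lipschitz (D1 H)" "torus_lipschitz (D2 H)"
    by (blast intro: torus_lipschitz_C_torus)+
  have H_diff: "H differentiable (at x)" for x
    using tl(2) unfolding torus_lipschitz_def by blast
  note tl_intros = torus_lipschitz_add torus_lipschitz_mult torus_lipschitz_sum
    torus_lipschitz_const torus_lipschitz_pair torus_lipschitz_diff tl
  have F0_tl: "torus_lipschitz (\<lambda>\<theta>. F0 \<theta> $ l)" for l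
  proof -
    have "torus_lipschitz (\<lambda>\<theta> :: real ^ 'n. \<omega> $ l + 1 / real CARD('n) *
        (\<Sum>m\<in>UNIV. H (\<theta> $ l, \<theta> $ m) * \<Gamma> (\<theta> $ m - \<theta> $ l)))"
      by (intro tl_intros)
    then show ?thesis
      by (simp add: F0_def reduced_field_def h_crit_def)
  qed
  have q_tl: "torus_lipschitz q"
    unfolding q_def by (intro tl_intros F0_tl)
  have u0_tl: "torus_lipschitz u0"
    unfolding u0_def by (intro tl_intros)
  obtain L0 where L0: "L0-lipschitz_on UNIV u0"
    using u0_tl by (auto simp: torus_lipschitz_def bounded_lipschitz_on_def)
  obtain L1 where L1: "L1-lipschitz_on UNIV q"
    using q_tl by (auto simp: torus_lipschitz_def bounded_lipschitz_on_def)
  obtain G where G: "\<And>x. \<bar>\<Gamma> x\<bar> \<le> G"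
    using tl(1) by (auto simp: torus_lipschitz_def bounded_lipschitz_on_def)
  obtain M where M: "\<And>l \<theta>. \<bar>F0 \<theta> $ l\<bar> \<le> M l"
    using F0_tl by (simp add: torus_lipschitz_def bounded_lipschitz_on_def) metis
  have pos: "0 \<le> L0" "0 \<le> L1" "0 \<le> G"
    using L0 L1 lipschitz_on_nonneg G[of 0] by (blast, blast, linarith)
  \<comment> \<open>Each of the N components of \<open>F - F0\<close> is at most
    \<open>\<bar>C\<bar> * G * \<epsilon>\<close>, hence the norm is at most
    \<open>K1 * \<epsilon>\<close>. The absolute value is there because the sign of \<open>C\<close>
    is unknown.\<close>
  define K1 where "K1 = real CARD('n) * (\<bar>C\<bar> * G)"
  have K1: "0 \<le> K1" using pos by (simp add: K1_def)
  \<comment> \<open>The first summand bounds the derivative of \<open>u0\<close> along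
    \<open>F - F0\<close>, the second the derivative of \<open>q\<close> along
    \<open>F\<close>.\<close>
  define K where "K = L0 * K1 + L1 * ((\<Sum>l\<in>UNIV. M l) + K1)"
  show ?thesis
  proof (rule that[of K])
    fix \<epsilon> :: real and h :: "real ^ 'n \<Rightarrow> real ^ 'n ^ 'n" and \<theta> :: "real ^ 'n"
    assume \<epsilon>: "0 < \<epsilon>" "\<epsilon> < 1" and h: "h \<in> C_torus 3"
      and inv: "locally_invariant (adaptive_field \<omega> \<Gamma> H \<epsilon>) (range (\<lambda>\<theta>. (\<theta>, h \<theta>)))"
      and close: "\<And>\<theta>. norm (h \<theta> - h_crit H \<theta>) \<le> C * \<epsilon>"
    define F where "F = reduced_field \<omega> \<Gamma> h"
    define e where "e \<theta> = h \<theta> $ i $ j - u0 \<theta> + \<epsilon> * q \<theta>" for \<theta>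
    have F_F0_component: "\<bar>(F x - F0 x) $ l\<bar> \<le> \<bar>C\<bar> * G * \<epsilon>" for x l
    proof -
      have "(F x - F0 x) $ l
        = (1 / real CARD('n)) * (\<Sum>m\<in>UNIV. (h x - h_crit H x) $ l $ m * \<Gamma> (x $ m - x $ l))"
        by (simp add: F_def F0_def reduced_field_def algebra_simps sum_subtractf diff_divide_distrib)
      also have "\<bar>\<dots>\<bar> \<le> (1 / real CARD('n)) * (\<Sum>m\<in>(UNIV::'n set). \<bar>C\<bar> * \<epsilon> * G)"
        unfolding abs_mult
      proof (intro mult_mono order_trans[OF sum_abs] sum_mono)
        fix m
        have "\<bar>(h x - h_crit H x) $ l $ m\<bar> \<le> norm (h x - h_crit H x)"
          by (meson component_le_norm_cart Finite_Cartesian_Product.norm_nth_le order_trans)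
        also have "\<dots> \<le> \<bar>C\<bar> * \<epsilon>"
          using close[of x] \<epsilon> mult_right_mono[of C "\<bar>C\<bar>" \<epsilon>] by linarith
        finally show "\<bar>(h x - h_crit H x) $ l $ m * \<Gamma> (x $ m - x $ l)\<bar> \<le> \<bar>C\<bar> * \<epsilon> * G"
          unfolding abs_mult using G pos \<epsilon> by (intro mult_mono) auto
      qed auto
      also have "\<dots> = \<bar>C\<bar> * G * \<epsilon>" by simp
      finally show ?thesis .
    qed
    have F_F0: "norm (F x - F0 x) \<le> K1 * \<epsilon>" for x
    proof -
      have "norm (F x - F0 x) \<le> (\<Sum>l\<in>UNIV. \<bar>(F x - F0 x) $ l\<bar>)"
        by (rule norm_le_l1_cart)
      also have "\<dots> \<le> (\<Sum>l\<in>(UNIV::'n set). \<bar>C\<bar> * G * \<epsilon>)"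
        by (intro sum_mono F_F0_component)
      finally show ?thesis by (simp add: K1_def)
    qed
    \<comment> \<open>Since \<epsilon> is below 1, \<open>K1 * \<epsilon>\<close> is absorbed into
      \<open>K1\<close> and the bound does not depend on \<epsilon>.\<close>
    have F: "norm (F x) \<le> (\<Sum>l\<in>UNIV. M l) + K1" for x
    proof -
      have "norm (F0 x) \<le> (\<Sum>l\<in>UNIV. \<bar>F0 x $ l\<bar>)"
        by (rule norm_le_l1_cart)
      also have "\<dots> \<le> (\<Sum>l\<in>UNIV. M l)"
        by (intro sum_mono M)
      finally show ?thesis
        using F_F0[of x] norm_triangle_sub[of "F x" "F0 x"] mult_left_mono[of \<epsilon> 1 K1] K1 \<epsilon> by linarith
    qed
    let ?h' = "\<lambda>x. frechet_derivative h (at x)"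
      and ?u0' = "\<lambda>x. frechet_derivative u0 (at x)" and ?q' = "\<lambda>x. frechet_derivative q (at x)"
    have h': "(h has_derivative ?h' x) (at x)" for x
      using h by (intro C_torus_Suc_has_derivative[of _ 2]) (simp add: numeral_3_eq_3 numeral_2_eq_2)
    have u0': "(u0 has_derivative ?u0' x) (at x)" and q': "(q has_derivative ?q' x) (at x)" for x
      using u0_tl q_tl frechet_derivative_works unfolding torus_lipschitz_def by blast+
    \<comment> \<open>By the chain rule \<open>q\<close> is exactly the derivative of
      \<open>u0\<close> along \<open>F0\<close>; this produces the cancellation of the first-order
      terms below.\<close>
    have u0'_F0: "?u0' x (F0 x) = q x" for x
    proof -
      have "((\<lambda>\<theta>. (\<theta> $ i, \<theta> $ j)) has_derivative (\<lambda>v. (v $ i, v $ j))) (at x)"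
        by (intro bounded_linear_imp_has_derivative bounded_linear_Pair bounded_linear_vec_nth)
      moreover have "(H has_derivative frechet_derivative H (at (x $ i, x $ j))) (at (x $ i, x $ j))"
        using H_diff frechet_derivative_works by blast
      ultimately have "(u0 has_derivative (\<lambda>v. frechet_derivative H (at (x $ i, x $ j)) (v $ i, v $ j))) (at x)"
        unfolding u0_def by (rule has_derivative_compose)
      then have "?u0' x = (\<lambda>v. frechet_derivative H (at (x $ i, x $ j)) (v $ i, v $ j))"
        by (rule frechet_derivative_at[symmetric])
      then show ?thesis
        by (simp add: frechet_derivative_D1_D2[OF H_diff] q_def)
    qed
    define e' where "e' x v = ?h' x v $ i $ j - ?u0' x v + \<epsilon> * ?q' x v" for x v
    have "bounded_linear (\<lambda>A :: real ^ 'n ^ 'n. A $ i $ j)"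
      by (intro bounded_linear_compose[OF bounded_linear_vec_nth] bounded_linear_vec_nth)
    then have "((\<lambda>x. h x $ i $ j) has_derivative (\<lambda>v. ?h' x v $ i $ j)) (at x)" for x
      using h' by (rule bounded_linear.has_derivative)
    then have e': "(e has_derivative e' x) (at x)" for x
      unfolding e_def e'_def using u0' q' by (auto intro!: derivative_eq_intros)
    have "torus_periodic e"
      using h u0_tl q_tl by (simp add: e_def C_torus_def torus_lipschitz_def torus_periodic_def)
    moreover have "\<bar>e x\<bar> \<le> K * \<epsilon>\<^sup>2" if "e' x = (\<lambda>_. 0)" for x
    proof -
      have "?h' x (F x) $ i $ j = (u0 x - h x $ i $ j) / \<epsilon>"
        unfolding F_def u0_def
        using Suc inv h' by (rule slow_manifold_invariance_equation)
      then have "e x = \<epsilon> * q x - \<epsilon> * ?h' x (F x) $ i $ j"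
        using \<epsilon> by (simp add: e_def)
      \<comment> \<open>At a critical point the derivative of \<open>e\<close> vanishes along
        \<open>F x\<close>, which trades the uncontrolled derivative of \<open>h\<close> for those
        of \<open>u0\<close> and \<open>q\<close>.\<close>
      moreover have "e' x (F x) = 0"
        using that by simp
      then have "?h' x (F x) $ i $ j = ?u0' x (F x) - \<epsilon> * ?q' x (F x)"
        by (simp add: e'_def)
      moreover have "?u0' x (F x) = q x + ?u0' x (F x - F0 x)"
        using linear_diff[OF has_derivative_linear[OF u0'[of x]]] u0'_F0[of x] by simp
      \<comment> \<open>The two occurrences of \<open>\<epsilon> * q x\<close> cancel. Both
        remaining terms are of second order, the last one because \<open>F - F0\<close> is itself of
        order \<epsilon>.\<close>
      ultimately have "e x = \<epsilon>\<^sup>2 * ?q' x (F x) - \<epsilon> * ?u0' x (F x - F0 x)"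
        by (simp add: algebra_simps power2_eq_square)
      moreover have "\<bar>\<epsilon> * ?u0' x (F x - F0 x)\<bar> \<le> \<epsilon> * (L0 * (K1 * \<epsilon>))"
        unfolding abs_mult using \<epsilon> pos F_F0
        by (intro mult_mono order_trans[OF has_derivative_bound_of_lipschitz[OF L0 u0']]) auto
      moreover have "\<bar>\<epsilon>\<^sup>2 * ?q' x (F x)\<bar> \<le> \<epsilon>\<^sup>2 * (L1 * ((\<Sum>l\<in>UNIV. M l) + K1))"
        unfolding abs_mult using \<epsilon> pos F
        by (intro mult_mono order_trans[OF has_derivative_bound_of_lipschitz[OF L1 q']]) auto
      ultimately show ?thesis
        by (simp add: K_def algebra_simps power2_eq_square)
    qed
    ultimately have "\<bar>e \<theta>\<bar> \<le> K * \<epsilon>\<^sup>2"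
      using torus_periodic_le_of_critical[OF _ e'] by blast
    then show "\<bar>h \<theta> $ i $ j - H (\<theta> $ i, \<theta> $ j) + \<epsilon> * q \<theta>\<bar> \<le> K * \<epsilon>\<^sup>2"
      by (simp add: e_def u0_def)
  qed
qed

section \<open>Mixed differences\<close>

text \<open>A discrete counterpart of the mixed partial derivative that involves only values of
  \<open>f\<close>, so it can be applied to a remainder known to be small merely in the uniform
  norm.\<close>

definition mixed_difference ::
  "'n::finite \<Rightarrow> 'n \<Rightarrow> real \<Rightarrow> real \<Rightarrow> (real ^ 'n \<Rightarrow> real) \<Rightarrow> real ^ 'n \<Rightarrow> real" where
  "mixed_difference j k a b f \<theta> =
     f (\<theta> + a *\<^sub>R axis j 1 + b *\<^sub>R axis k 1) - f (\<theta> + a *\<^sub>R axis j 1) - f (\<theta> + b *\<^sub>R axis k 1) + f \<theta>"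

lemma mixed_difference_add:
  "mixed_difference j k a b (\<lambda>\<theta>. f \<theta> + g \<theta>) \<theta>
    = mixed_difference j k a b f \<theta> + mixed_difference j k a b g \<theta>"
  by (simp add: mixed_difference_def)

lemma mixed_difference_cmult:
  "mixed_difference j k a b (\<lambda>\<theta>. c * f \<theta>) \<theta> = c * mixed_difference j k a b f \<theta>"
  by (simp add: mixed_difference_def algebra_simps)

lemma mixed_difference_sum:
  "mixed_difference j k a b (\<lambda>\<theta>. \<Sum>l\<in>I. f l \<theta>) \<theta> = (\<Sum>l\<in>I. mixed_difference j k a b (f l) \<theta>)"
  by (simp add: mixed_difference_def sum.distrib sum_subtractf)

lemma mixed_difference_bound:
  assumes "\<And>\<theta>. \<bar>f \<theta>\<bar> \<le> M"
  shows "\<bar>mixed_difference j k a b f \<theta>\<bar> \<le> 4 * M"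
  using assms[of "\<theta> + a *\<^sub>R axis j 1 + b *\<^sub>R axis k 1"] assms[of "\<theta> + a *\<^sub>R axis j 1"]
    assms[of "\<theta> + b *\<^sub>R axis k 1"] assms[of \<theta>]
  unfolding mixed_difference_def by linarith

text \<open>The summand for \<open>l\<close> sees only the coordinates \<open>i\<close> and
  \<open>l\<close>. Coordinate \<open>i\<close> is never moved, and \<open>l\<close> differs from
  \<open>j\<close> or from \<open>k\<close>, so one of the two increments has no effect and the
  difference cancels.\<close>

lemma mixed_difference_pairwise:
  fixes i j k :: "'n::finite"
  assumes "i \<noteq> j" "i \<noteq> k" "j \<noteq> k"
  shows "mixed_difference j k a b (\<lambda>\<theta>. \<Sum>l\<in>UNIV. G l (\<theta> $ i, \<theta> $ l)) \<theta> = 0"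
proof -
  have "mixed_difference j k a b (\<lambda>\<theta>. G l (\<theta> $ i, \<theta> $ l)) \<theta> = 0" for l
    using assms by (cases "l = j"; cases "l = k") (auto simp: mixed_difference_def axis_def)
  then show ?thesis
    by (simp add: mixed_difference_sum)
qed

text \<open>Both functions have the same difference quotients, so the predicates from which
  \<open>deriv\<close> selects a value coincide; this covers functions that are not
  differentiable.\<close>

lemma deriv_add_const: "deriv (\<lambda>t. f t + c) x = deriv f x"
proof -
  have "((\<lambda>t. f t + c) has_field_derivative D) (at x) \<longleftrightarrow> (f has_field_derivative D) (at x)" for D
    by (simp add: DERIV_def)
  then show ?thesis
    by (simp add: deriv_def)
qed

text \<open>Vanishing differences mean that the slices of \<open>f\<close> in direction
  \<open>k\<close> through points displaced along \<open>j\<close> differ by constants only, so the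
  derivative in \<open>k\<close> is constant along that line. The contrapositive extracts suitable
  increments from a nonzero mixed derivative.\<close>

lemma partial_deriv_eq_0_of_mixed_difference:
  assumes "\<And>a b. mixed_difference j k a b f \<theta> = 0"
  shows "partial_deriv j (partial_deriv k f) \<theta> = 0"
proof -
  have "f (\<theta> + a *\<^sub>R axis j 1 + b *\<^sub>R axis k 1) = f (\<theta> + b *\<^sub>R axis k 1) + (f (\<theta> + a *\<^sub>R axis j 1) - f \<theta>)"
    for a b
    using assms[of a b] by (simp add: mixed_difference_def)
  then have "partial_deriv k f (\<theta> + a *\<^sub>R axis j 1) = partial_deriv k f \<theta>" for a
    unfolding partial_deriv_def by (simp only: deriv_add_const)
  then show ?thesis
    unfolding partial_deriv_def[of j] by simp
qed

text \<open>Substituting the first-order expansion with remainder \<open>e\<close>, the frequency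
  part of \<open>F0\<close> gives terms in the coordinates \<open>i\<close> and \<open>r\<close>
  alone, while its coupling sums over \<open>s\<close> give exactly the \<open>T_term\<close>s. One
  factor 1/N comes from the reduced field and another from \<open>F0\<close>.\<close>

lemma reduced_field_decomposition:
  fixes \<omega> :: "real ^ 'n" and \<Gamma> :: "real \<Rightarrow> real" and H :: "real \<times> real \<Rightarrow> real"
    and g :: "real ^ 'n \<Rightarrow> real ^ 'n ^ 'n" and \<epsilon> :: real and i :: 'n
  defines "N \<equiv> real CARD('n)"
  defines "F0 \<equiv> reduced_field \<omega> \<Gamma> (h_crit H)"
  defines "e \<equiv> \<lambda>r \<theta>. g \<theta> $ i $ r - H (\<theta> $ i, \<theta> $ r)
    + \<epsilon> * (D1 H (\<theta> $ i, \<theta> $ r) * F0 \<theta> $ i + D2 H (\<theta> $ i, \<theta> $ r) * F0 \<theta> $ r)"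
  obtains G where "\<And>\<theta>. reduced_field \<omega> \<Gamma> g \<theta> $ i = (\<Sum>r\<in>UNIV. G r (\<theta> $ i, \<theta> $ r))
    + \<epsilon> / N\<^sup>2 * (\<Sum>r\<in>UNIV. \<Sum>s\<in>UNIV. T_term \<Gamma> H i r s \<theta>)
    + 1 / N * (\<Sum>r\<in>UNIV. e r \<theta> * \<Gamma> (\<theta> $ r - \<theta> $ i))"
proof -
  have N: "N > 0" by (simp add: N_def)
  \<comment> \<open>The constant \<omega>_i is spread evenly over the N summands. The other terms
    are the coupling on the critical manifold and the frequency part of the first-order
    correction.\<close>
  define G where "G = (\<lambda>r (u, v). \<omega> $ i / N + 1 / N * (H (u, v) * \<Gamma> (v - u))
    - \<epsilon> / N * (\<Gamma> (v - u) * (D1 H (u, v) * \<omega> $ i + D2 H (u, v) * \<omega> $ r)))"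
  have "reduced_field \<omega> \<Gamma> g \<theta> $ i = (\<Sum>r\<in>UNIV. G r (\<theta> $ i, \<theta> $ r))
    + \<epsilon> / N\<^sup>2 * (\<Sum>r\<in>UNIV. \<Sum>s\<in>UNIV. T_term \<Gamma> H i r s \<theta>)
    + 1 / N * (\<Sum>r\<in>UNIV. e r \<theta> * \<Gamma> (\<theta> $ r - \<theta> $ i))" for \<theta>
  proof -
    define S where "S r = (\<Sum>s\<in>UNIV. H (\<theta> $ r, \<theta> $ s) * \<Gamma> (\<theta> $ s - \<theta> $ r))" for r
    have F0: "F0 \<theta> $ r = \<omega> $ r + 1 / N * S r" for r
      by (simp add: F0_def reduced_field_def h_crit_def S_def N_def)
    have T: "(\<Sum>s\<in>UNIV. T_term \<Gamma> H i r s \<theta>)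
      = - (\<Gamma> (\<theta> $ r - \<theta> $ i) * (D1 H (\<theta> $ i, \<theta> $ r) * S i + D2 H (\<theta> $ i, \<theta> $ r) * S r))" for r
      unfolding T_term_def S_def
      by (simp add: sum_subtractf sum_distrib_left sum_negf algebra_simps)
    have "\<omega> $ i / N + 1 / N * (g \<theta> $ i $ r * \<Gamma> (\<theta> $ r - \<theta> $ i)) = G r (\<theta> $ i, \<theta> $ r)
      + \<epsilon> / N\<^sup>2 * (\<Sum>s\<in>UNIV. T_term \<Gamma> H i r s \<theta>) + 1 / N * (e r \<theta> * \<Gamma> (\<theta> $ r - \<theta> $ i))" for r
      unfolding T G_def e_def F0 using N by (simp add: field_simps power2_eq_square)
    then have "(\<Sum>r\<in>UNIV. \<omega> $ i / N + 1 / N * (g \<theta> $ i $ r * \<Gamma> (\<theta> $ r - \<theta> $ i)))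
      = (\<Sum>r\<in>UNIV. G r (\<theta> $ i, \<theta> $ r) + \<epsilon> / N\<^sup>2 * (\<Sum>s\<in>UNIV. T_term \<Gamma> H i r s \<theta>)
          + 1 / N * (e r \<theta> * \<Gamma> (\<theta> $ r - \<theta> $ i)))"
      by simp
    moreover have "(\<Sum>r\<in>UNIV. \<omega> $ i / N + 1 / N * (g \<theta> $ i $ r * \<Gamma> (\<theta> $ r - \<theta> $ i)))
      = reduced_field \<omega> \<Gamma> g \<theta> $ i"
      by (simp add: reduced_field_def sum.distrib sum_divide_distrib N_def)
    ultimately show ?thesis
      by (simp add: sum.distrib sum_distrib_left)
  qed
  then show ?thesis by (rule that)
qed

section \<open>Obstruction to a pairwise reduced field for small \<epsilon>\<close>

theorem theorem4p5:
  fixes \<omega> :: "real ^ 'n"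
    and \<Gamma> :: "real \<Rightarrow> real"
    and H :: "real \<times> real \<Rightarrow> real"
    and h :: "real \<Rightarrow> real ^ 'n \<Rightarrow> real ^ 'n ^ 'n"
    and i j k :: 'n
    and \<theta>s :: "real ^ 'n"
  assumes "CARD('n) \<ge> 3"
    and "\<Gamma> \<in> C_torus 3"
    and "H \<in> C_torus 3"
    and "slow_manifold_family \<omega> \<Gamma> H h"
    and "i \<noteq> j" "i \<noteq> k" "j \<noteq> k"
    and "partial_deriv j (partial_deriv k (\<lambda>\<theta>. \<Sum>r\<in>UNIV. \<Sum>s\<in>UNIV. T_term \<Gamma> H i r s \<theta>)) \<theta>s \<noteq> 0"
  shows "\<forall>\<^sub>F \<epsilon> in at_right 0. reduced_field \<omega> \<Gamma> (h \<epsilon>) \<notin> V_pair"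
proof -
  define N where "N = real CARD('n)"
  have N: "N > 0" by (simp add: N_def)
  define T where "T \<theta> = (\<Sum>r\<in>UNIV. \<Sum>s\<in>UNIV. T_term \<Gamma> H i r s \<theta>)" for \<theta> :: "real ^ 'n"
  define F0 where "F0 = reduced_field \<omega> \<Gamma> (h_crit H)"
  define e where "e \<epsilon> r \<theta> = h \<epsilon> \<theta> $ i $ r - H (\<theta> $ i, \<theta> $ r)
    + \<epsilon> * (D1 H (\<theta> $ i, \<theta> $ r) * F0 \<theta> $ i + D2 H (\<theta> $ i, \<theta> $ r) * F0 \<theta> $ r)" for \<epsilon> r \<theta>
  \<comment> \<open>The increments are fixed before \<epsilon>, so \<open>m\<close> below is a
    nonzero number independent of \<epsilon>.\<close>
  obtain a b where ab: "mixed_difference j k a b T \<theta>s \<noteq> 0"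
    using partial_deriv_eq_0_of_mixed_difference assms(8) unfolding T_def by blast
  define m where "m = mixed_difference j k a b T \<theta>s"
  define slow where "slow C \<epsilon> \<longleftrightarrow> h \<epsilon> \<in> C_torus 3 \<and>
     locally_invariant (adaptive_field \<omega> \<Gamma> H \<epsilon>) (range (\<lambda>\<theta>. (\<theta>, h \<epsilon> \<theta>))) \<and>
     (\<forall>\<theta>. norm (h \<epsilon> \<theta> - h_crit H \<theta>) \<le> C * \<epsilon>)" for C \<epsilon>
  obtain C where C: "\<forall>\<^sub>F \<epsilon> in at_right 0. slow C \<epsilon>"
    using assms(4) unfolding slow_manifold_family_def slow_def by blast
  have "\<exists>K. \<forall>\<epsilon> \<theta>. \<epsilon> \<in> {0<..<1} \<longrightarrow> slow C \<epsilon> \<longrightarrow> \<bar>e \<epsilon> r \<theta>\<bar> \<le> K * \<epsilon>\<^sup>2" for r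
  proof (rule slow_manifold_first_order_expansion[OF assms(2,3),
        where \<omega> = \<omega> and i = i and j = r and C = C], goal_cases)
    case (1 K)
    have "\<bar>e \<epsilon> r \<theta>\<bar> \<le> K * \<epsilon>\<^sup>2" if "\<epsilon> \<in> {0<..<1}" "slow C \<epsilon>" for \<epsilon> \<theta>
      unfolding e_def F0_def using that by (intro 1) (auto simp: slow_def)
    then show ?case by blast
  qed
  then obtain K where K: "\<And>r \<epsilon> \<theta>. \<epsilon> \<in> {0<..<1} \<Longrightarrow> slow C \<epsilon> \<Longrightarrow> \<bar>e \<epsilon> r \<theta>\<bar> \<le> K r * \<epsilon>\<^sup>2"
    by metis
  have "bounded_lipschitz_on UNIV \<Gamma>"
    using assms(2) by (intro C_torus_bounded_lipschitz[of _ 2]) (simp add: numeral_3_eq_3 numeral_2_eq_2)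
  then obtain B where B: "\<And>x. \<bar>\<Gamma> x\<bar> \<le> B"
    by (auto simp: bounded_lipschitz_on_def)
  \<comment> \<open>The factor 4 counts the values in a mixed difference, N is left after clearing
    denominators, and the rest bounds the remainder \<open>R\<close> divided by the square of
    \<epsilon>.\<close>
  define Q where "Q = 4 * N * B * (\<Sum>r\<in>UNIV. K r)"
  have "((\<lambda>\<epsilon>. Q * \<epsilon>) \<longlongrightarrow> Q * 0) (at_right 0)"
    by (intro tendsto_intros)
  then have "\<forall>\<^sub>F \<epsilon> in at_right 0. Q * \<epsilon> < \<bar>m\<bar>"
    by (rule order_tendstoD) (use ab in \<open>simp add: m_def\<close>)
  moreover have "\<forall>\<^sub>F \<epsilon> in at_right 0. \<epsilon> \<in> {0<..<1::real}"
    by (rule eventually_at_right_real) simp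
  ultimately show ?thesis
    using C
  proof eventually_elim
    case (elim \<epsilon>)
    then have \<epsilon>: "0 < \<epsilon>" "\<epsilon> < 1" by auto
    define R where "R \<theta> = (\<Sum>r\<in>UNIV. e \<epsilon> r \<theta> * \<Gamma> (\<theta> $ r - \<theta> $ i))" for \<theta>
    have R_bound: "\<bar>R \<theta>\<bar> \<le> B * (\<Sum>r\<in>UNIV. K r) * \<epsilon>\<^sup>2" for \<theta>
    proof -
      have e_bound: "\<bar>e \<epsilon> r \<theta>\<bar> \<le> K r * \<epsilon>\<^sup>2" for r
        using K elim by blast
      have "\<bar>R \<theta>\<bar> \<le> (\<Sum>r\<in>UNIV. \<bar>e \<epsilon> r \<theta>\<bar> * \<bar>\<Gamma> (\<theta> $ r - \<theta> $ i)\<bar>)"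
        unfolding R_def abs_mult[symmetric] by (rule sum_abs)
      also have "\<dots> \<le> (\<Sum>r\<in>UNIV. (K r * \<epsilon>\<^sup>2) * B)"
        using e_bound B order_trans[OF abs_ge_zero e_bound] by (intro sum_mono mult_mono) auto
      finally show ?thesis
        by (simp add: sum_distrib_left sum_distrib_right mult_ac)
    qed
    show ?case
    proof
      assume "reduced_field \<omega> \<Gamma> (h \<epsilon>) \<in> V_pair"
      then obtain G where G: "\<And>\<theta>. reduced_field \<omega> \<Gamma> (h \<epsilon>) \<theta> $ i = (\<Sum>l\<in>UNIV. G l (\<theta> $ i, \<theta> $ l))"
        unfolding V_pair_def by blast
      have "\<exists>G'. \<forall>\<theta>. reduced_field \<omega> \<Gamma> (h \<epsilon>) \<theta> $ i
          = (\<Sum>l\<in>UNIV. G' l (\<theta> $ i, \<theta> $ l)) + \<epsilon> / N\<^sup>2 * T \<theta> + 1 / N * R \<theta>"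
        unfolding T_def R_def e_def F0_def N_def
        by (rule reduced_field_decomposition[where \<omega> = \<omega> and \<Gamma> = \<Gamma> and g = "h \<epsilon>" and i = i
              and H = H and \<epsilon> = \<epsilon>], intro exI allI)
      then obtain G' where G': "\<And>\<theta>. reduced_field \<omega> \<Gamma> (h \<epsilon>) \<theta> $ i
          = (\<Sum>l\<in>UNIV. G' l (\<theta> $ i, \<theta> $ l)) + \<epsilon> / N\<^sup>2 * T \<theta> + 1 / N * R \<theta>"
        by blast
      \<comment> \<open>The mixed difference is evaluated twice: the assumed pairwise form gives
        zero, the decomposition leaves \<open>T\<close> and the remainder.\<close>
      have "0 = mixed_difference j k a b (\<lambda>\<theta>. reduced_field \<omega> \<Gamma> (h \<epsilon>) \<theta> $ i) \<theta>s"
        unfolding G using assms(5-7) by (simp add: mixed_difference_pairwise)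
      also have "\<dots> = \<epsilon> / N\<^sup>2 * m + 1 / N * mixed_difference j k a b R \<theta>s"
        unfolding G' mixed_difference_add mixed_difference_cmult m_def
        using assms(5-7) by (simp add: mixed_difference_pairwise)
      finally have "\<epsilon> * m = - N * mixed_difference j k a b R \<theta>s"
        using N by (simp add: field_simps power2_eq_square)
      then have "\<epsilon> * \<bar>m\<bar> = N * \<bar>mixed_difference j k a b R \<theta>s\<bar>"
        using \<epsilon> N by (metis abs_minus_cancel abs_mult abs_of_pos mult_minus_left)
      also have "\<dots> \<le> N * (4 * (B * (\<Sum>r\<in>UNIV. K r) * \<epsilon>\<^sup>2))"
        using N by (intro mult_left_mono mixed_difference_bound R_bound) auto
      also have "\<dots> = \<epsilon> * (Q * \<epsilon>)"
        by (simp add: Q_def power2_eq_square)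
      \<comment> \<open>Dividing by \<epsilon> gives
        \<open>\<bar>m\<bar> \<le> Q * \<epsilon>\<close>, against the choice of \<epsilon>.\<close>
      finally show False
        using elim(1) \<epsilon> by simp
    qed
  qed
qed

end
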